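(* Let $(X,d)$ be a Ptolemaic metric space and let $U\subset X$ be an open set with non-empty boundary $\partial U$. For $x,y\in U$ put $$\rho_U(x,y)=\sup_{p\in\partial U}\log\left(1+\frac{d(x,y)}{d(p,x)\,d(p,y)}\right).$$ Then $(U,\rho_U)$ is Gromov hyperbolic with parameter $\log 2$ and strongly hyperbolic with parameter $1$. Moreover, these parameters are sharp in general when $\partial U$ contains at least two distinct points, in the following sense: for every $\delta$ with $0<\delta<\log 2$ there exist a Ptolemaic metric space $(X,d)$ and an open set $U\subset X$ whose boundary contains at least two distinct points such that $(U,\rho_U)$ is not Gromov hyperbolic with parameter $\delta$; and for every $\epsilon>1$ there exist a Ptolemaic metric space $(X,d)$ and an open set $U\subset X$ whose boundary contains at least two distinct points such that $(U,\rho_U)$ is not strongly hyperbolic with parameter $\epsilon$.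
   Context: A metric space $(X,d)$ is Ptolemaic iff $d(x,y)\,d(z,t)\leq d(x,z)\,d(y,t)+d(x,t)\,d(y,z)$ for all $x,y,z,t\in X$. A metric space $(X,d)$ is Gromov hyperbolic with parameter $\delta>0$ iff $$d(x,y)+d(z,t)\leq\max\{d(x,z)+d(y,t),\,d(x,t)+d(y,z)\}+2\delta$$ for all $x,y,z,t\in X$. A metric space $(X,d)$ is strongly hyperbolic with parameter $\epsilon>0$ iff $$\exp\left(\tfrac{\epsilon}{2}d(x,y)+\tfrac{\epsilon}{2}d(z,t)\right)\leq\exp\left(\tfrac{\epsilon}{2}d(x,z)+\tfrac{\epsilon}{2}d(y,t)\right)+\exp\left(\tfrac{\epsilon}{2}d(x,t)+\tfrac{\epsilon}{2}d(y,z)\right)$$ for all $x,y,z,t\in X$. $\partial U$ is the topological boundary of $U$ in $X$. It is known (Z. Zhang and Y. Xiao) that $\rho_U$ is a metric on $U$ whenever $(X,d)$ is Ptolemaic and $U\subset X$ is open with non-empty boundary. *)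

theory Defs
  imports "HOL-Analysis.Abstract_Metric_Spaces"
begin

definition ptolemaic :: "'a set \<Rightarrow> ('a \<Rightarrow> 'a \<Rightarrow> real) \<Rightarrow> bool" where
  "ptolemaic X d \<longleftrightarrow>
    (\<forall>x\<in>X. \<forall>y\<in>X. \<forall>z\<in>X. \<forall>t\<in>X. d x y * d z t \<le> d x z * d y t + d x t * d y z)"

definition gromov_hyperbolic :: "'a set \<Rightarrow> ('a \<Rightarrow> 'a \<Rightarrow> real) \<Rightarrow> real \<Rightarrow> bool" where
  "gromov_hyperbolic X d \<delta> \<longleftrightarrow>
    (\<forall>x\<in>X. \<forall>y\<in>X. \<forall>z\<in>X. \<forall>t\<in>X.
      d x y + d z t \<le> max (d x z + d y t) (d x t + d y z) + 2 * \<delta>)"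

definition strongly_hyperbolic :: "'a set \<Rightarrow> ('a \<Rightarrow> 'a \<Rightarrow> real) \<Rightarrow> real \<Rightarrow> bool" where
  "strongly_hyperbolic X d \<epsilon> \<longleftrightarrow>
    (\<forall>x\<in>X. \<forall>y\<in>X. \<forall>z\<in>X. \<forall>t\<in>X.
      exp (\<epsilon> / 2 * d x y + \<epsilon> / 2 * d z t)
        \<le> exp (\<epsilon> / 2 * d x z + \<epsilon> / 2 * d y t) + exp (\<epsilon> / 2 * d x t + \<epsilon> / 2 * d y z))"

abbreviation boundary :: "'a set \<Rightarrow> ('a \<Rightarrow> 'a \<Rightarrow> real) \<Rightarrow> 'a set \<Rightarrow> 'a set" where
  "boundary X d U \<equiv> Metric_space.mtopology X d frontier_of U"

text \<open>
  The value 0 off \<open>U\<close> is a convention: the locale \<^locale>\<open>Metric_space\<close> requires nonnegativity and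
  symmetry of the distance function at all arguments, also outside the carrier. On \<open>U\<close> the
  denominators are nonzero and the supremum is finite when \<open>U\<close> is open with nonempty boundary.
\<close>

definition rho :: "'a set \<Rightarrow> ('a \<Rightarrow> 'a \<Rightarrow> real) \<Rightarrow> 'a set \<Rightarrow> 'a \<Rightarrow> 'a \<Rightarrow> real" where
  "rho X d U x y =
    (if x \<in> U \<and> y \<in> U then SUP p\<in>boundary X d U. ln (1 + d x y / (d p x * d p y)) else 0)"

end

theory Submission
  imports Defs "HOL-Analysis.Line_Segment"
begin

text \<open>
  By Ptolemy's inequality each inversion \<open>d x y / (d p x * d p y)\<close> is a metric on \<open>U\<close>, hence so is
  the supremum \<open>M\<close> of these over the boundary. This supremum need not be Ptolemaic, but
  \<open>exp \<circ> \<rho> = 1 + M\<close> satisfies the triangle inequality, and the square root of a function that does so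
  satisfies Ptolemy's inequality; this is strong hyperbolicity with parameter 1. Strong
  hyperbolicity with parameter \<open>\<epsilon>\<close> implies Gromov hyperbolicity with parameter \<open>ln 2 / \<epsilon>\<close>, so one
  example showing that \<open>ln 2\<close> is sharp settles both sharpness claims; \<open>\<real> - {0, 1}\<close> is such an example.
\<close>

section \<open>Four-point inequalities and hyperbolicity\<close>

text \<open>Read \<open>p\<close>, \<open>q\<close> as the diagonals of a quadrilateral with
  opposite sides \<open>a\<close>, \<open>b\<close> and \<open>c\<close>, \<open>e\<close>: the
  bounds are the triangle inequalities, and the conclusion is the square of Ptolemy's inequality for
  the square roots of the lengths.\<close>

lemma mult_le_of_four_point:
  fixes a b c e p q :: real
  assumes nonneg: "0 \<le> a" "0 \<le> b" "0 \<le> c" "0 \<le> e" "0 \<le> p" "0 \<le> q"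
    and p: "p \<le> a + e" "p \<le> b + c" and q: "q \<le> a + c" "q \<le> b + e"
  shows "p * q \<le> (sqrt (a * b) + sqrt (c * e))\<^sup>2"
proof -
  \<comment> \<open>By symmetry \<open>a\<close> and \<open>c\<close> may be taken as the smaller
    sides of their pairs: exchanging \<open>a\<close> with \<open>b\<close>, or \<open>c\<close>
    with \<open>e\<close>, swaps the roles of \<open>p\<close> and \<open>q\<close>.\<close>
  have ordered: "p * q \<le> (sqrt (a * b) + sqrt (c * e))\<^sup>2"
    if nonneg: "0 \<le> a" "0 \<le> b" "0 \<le> c" "0 \<le> e" "0 \<le> p" "0 \<le> q"
      and p: "p \<le> a + e" "p \<le> b + c" and q: "q \<le> a + c" and ord: "a \<le> b" "c \<le> e"
    for a b c e p q :: real
  proof -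
    have "a \<le> sqrt (a * b)" "c \<le> sqrt (c * e)"
      using nonneg ord by (auto intro!: real_le_rsqrt simp: power2_eq_square mult_left_mono)
    then have ac: "a * c \<le> sqrt (a * b) * sqrt (c * e)"
      using nonneg by (intro mult_mono) auto
    have "p * q \<le> a * b + c * e + 2 * (a * c)"
    \<comment> \<open>The smaller bound on \<open>p\<close> is multiplied by the bound on
      \<open>q\<close>. The case assumption then trades the unwanted square, \<open>a * a\<close> or
      \<open>c * c\<close>, for products that are allowed.\<close>
    proof (cases "a + e \<le> b + c")
      case True
      have "p * q \<le> (a + e) * (a + c)"
        using nonneg p q by (intro mult_mono) auto
      moreover have "a * (a + e) \<le> a * (b + c)"
        using True nonneg by (intro mult_left_mono) auto
      ultimately show ?thesis by (simp add: algebra_simps)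
    next
      case False
      have "p * q \<le> (b + c) * (a + c)"
        using nonneg p q by (intro mult_mono) auto
      moreover have "c * (b + c) \<le> c * (a + e)"
        using False nonneg by (intro mult_left_mono) auto
      ultimately show ?thesis by (simp add: algebra_simps)
    qed
    also have "\<dots> \<le> (sqrt (a * b) + sqrt (c * e))\<^sup>2"
      using ac nonneg by (simp add: power2_sum)
    finally show ?thesis .
  qed
  consider "a \<le> b" "c \<le> e" | "a \<le> b" "e \<le> c" | "b \<le> a" "c \<le> e" | "b \<le> a" "e \<le> c"
    by linarith
  then show ?thesis
  proof cases
    case 1
    then show ?thesis using ordered[of a b c e p q] assms by simp
  next
    case 2
    then show ?thesis using ordered[of a b e c q p] assms by (simp add: mult.commute)
  next
    case 3
    then show ?thesis using ordered[of b a c e q p] assms by (simp add: ac_simps)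
  next
    case 4
    then show ?thesis using ordered[of b a e c p q] assms by (simp add: ac_simps)
  qed
qed

text \<open>For parameter 1 the exponentials are geometric means of values of
  \<open>exp (r _ _)\<close>, so the claim is Ptolemy's inequality for the square root of
  \<open>exp (r _ _)\<close>.\<close>

lemma strongly_hyperbolic_1_if_exp_triangle:
  fixes r :: "'a \<Rightarrow> 'a \<Rightarrow> real"
  assumes commute: "\<And>x y. r x y = r y x"
    and triangle: "\<And>x y z. \<lbrakk>x \<in> X; y \<in> X; z \<in> X\<rbrakk> \<Longrightarrow> exp (r x y) \<le> exp (r x z) + exp (r z y)"
  shows "strongly_hyperbolic X r 1"
  unfolding strongly_hyperbolic_def
proof (intro ballI)
  fix x y z t
  assume X: "x \<in> X" "y \<in> X" "z \<in> X" "t \<in> X"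
  have half: "exp (1 / 2 * u + 1 / 2 * v) = sqrt (exp u * exp v)" for u v :: real
    by (rule real_sqrt_unique[symmetric])
      (simp_all add: power2_eq_square flip: exp_add)
  have "exp (r x y) * exp (r z t)
      \<le> (sqrt (exp (r x z) * exp (r y t)) + sqrt (exp (r x t) * exp (r y z)))\<^sup>2"
    using triangle[of x y z] triangle[of x y t] triangle[of z t x] triangle[of z t y] X
    by (intro mult_le_of_four_point)
      (simp_all add: commute[of y x] commute[of z x] commute[of z y] commute[of t x]
        commute[of t y] commute[of t z] add.commute)
  then have "sqrt (exp (r x y) * exp (r z t))
      \<le> sqrt (exp (r x z) * exp (r y t)) + sqrt (exp (r x t) * exp (r y z))"
    by (intro real_le_lsqrt) simp_all
  then show "exp (1 / 2 * r x y + 1 / 2 * r z t)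
      \<le> exp (1 / 2 * r x z + 1 / 2 * r y t) + exp (1 / 2 * r x t + 1 / 2 * r y z)"
    by (simp only: half)
qed

text \<open>A sum of two exponentials is at most twice the larger one; after taking logarithms this
  factor 2 becomes the additive error.\<close>

lemma gromov_hyperbolic_if_strongly_hyperbolic:
  assumes "strongly_hyperbolic X r \<epsilon>" "0 < \<epsilon>"
  shows "gromov_hyperbolic X r (ln 2 / \<epsilon>)"
  unfolding gromov_hyperbolic_def
proof (intro ballI)
  fix x y z t
  assume X: "x \<in> X" "y \<in> X" "z \<in> X" "t \<in> X"
  define m where "m = max (r x z + r y t) (r x t + r y z)"
  have "exp (\<epsilon> / 2 * (r x y + r z t))
      \<le> exp (\<epsilon> / 2 * (r x z + r y t)) + exp (\<epsilon> / 2 * (r x t + r y z))"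
    using assms(1) X unfolding strongly_hyperbolic_def by (simp only: distrib_left)
  also have "\<dots> \<le> exp (\<epsilon> / 2 * m) + exp (\<epsilon> / 2 * m)"
    using \<open>0 < \<epsilon>\<close> by (intro add_mono) (simp_all add: m_def)
  also have "\<dots> = exp (ln 2 + \<epsilon> / 2 * m)"
    by (simp add: exp_add)
  finally have "\<epsilon> / 2 * (r x y + r z t) \<le> ln 2 + \<epsilon> / 2 * m"
    by simp
  then show "r x y + r z t \<le> max (r x z + r y t) (r x t + r y z) + 2 * (ln 2 / \<epsilon>)"
    using \<open>0 < \<epsilon>\<close> unfolding m_def[symmetric] by (simp add: field_simps)
qed

section \<open>The function \<open>rho\<close> on an open set with non-empty boundary\<close>

locale open_with_boundary = Metric_space +
  fixes U
  assumes open_U: "openin mtopology U"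
    and boundary_nonempty: "boundary M d U \<noteq> {}"
begin

lemma U_subset: "U \<subseteq> M"
  using openin_subset[OF open_U] by simp

lemma boundary_subset: "boundary M d U \<subseteq> M - U"
  using frontier_of_subset_topspace[of mtopology U] open_U frontier_of_disjoint_eq[OF openin_subset]
  by fastforce

lemma boundary_dist_pos: "\<lbrakk>p \<in> boundary M d U; x \<in> U\<rbrakk> \<Longrightarrow> 0 < d p x"
  using boundary_subset U_subset by (metis Diff_iff mdist_pos_eq subsetD)

text \<open>Balls around \<open>x\<close> and \<open>y\<close> inside \<open>U\<close> contain no
  boundary point, so their radii bound the denominators from below.\<close>

lemma bdd_above_rho:
  assumes x: "x \<in> U" and y: "y \<in> U"
  shows "bdd_above ((\<lambda>p. ln (1 + d x y / (d p x * d p y))) ` boundary M d U)"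
proof -
  obtain a b where ab: "a > 0" "mball x a \<subseteq> U" "b > 0" "mball y b \<subseteq> U"
    using open_U x y unfolding openin_mtopology by metis
  have "ln (1 + d x y / (d p x * d p y)) \<le> ln (1 + d x y / (a * b))"
    if p: "p \<in> boundary M d U" for p
  proof -
    have "p \<in> M" "p \<notin> U" using boundary_subset p by auto
    then have "a \<le> d p x" "b \<le> d p y"
      using ab x y U_subset by (force simp: commute)+
    then show ?thesis using ab by (simp add: add_pos_nonneg divide_left_mono mult_mono frac_le)
  qed
  then show ?thesis by (intro bdd_aboveI2)
qed

text \<open>Together with \<open>exp_rho_le\<close>, this describes
  \<open>exp (rho M d U x y)\<close> as a least upper bound, so later arguments need neither
  logarithms nor suprema.\<close>

lemma exp_rho_ge:
  assumes "x \<in> U" "y \<in> U" "p \<in> boundary M d U"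
  shows "1 + d x y / (d p x * d p y) \<le> exp (rho M d U x y)"
proof -
  have "ln (1 + d x y / (d p x * d p y)) \<le> rho M d U x y"
    using assms cSUP_upper[OF assms(3) bdd_above_rho] by (simp add: rho_def)
  then have "exp (ln (1 + d x y / (d p x * d p y))) \<le> exp (rho M d U x y)"
    by simp
  then show ?thesis
    by (simp add: add_pos_nonneg)
qed

lemma exp_rho_le:
  assumes "x \<in> U" "y \<in> U"
    and "\<And>p. p \<in> boundary M d U \<Longrightarrow> 1 + d x y / (d p x * d p y) \<le> c"
  shows "exp (rho M d U x y) \<le> c"
proof -
  have pos: "0 < 1 + d x y / (d p x * d p y)" for p
    by (simp add: add_pos_nonneg)
  obtain p where "p \<in> boundary M d U" using boundary_nonempty by blast
  with assms(3) pos have "0 < c" by (meson order_less_le_trans)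
  then have "rho M d U x y \<le> ln c"
    using assms boundary_nonempty pos by (auto simp: rho_def intro!: cSUP_least)
  then show ?thesis using \<open>0 < c\<close> by (metis exp_le_cancel_iff exp_ln)
qed

lemma rho_commute: "rho M d U x y = rho M d U y x"
  by (simp add: rho_def commute[of x y] mult.commute)

lemma rho_nonneg: "0 \<le> rho M d U x y"
proof (cases "x \<in> U \<and> y \<in> U")
  case True
  obtain p where "p \<in> boundary M d U" using boundary_nonempty by blast
  moreover have "0 \<le> d x y / (d p x * d p y)" by simp
  ultimately have "1 \<le> exp (rho M d U x y)"
    using exp_rho_ge[of x y p] True by linarith
  then show ?thesis by simp
qed (auto simp: rho_def)

lemma rho_eq_0_iff:
  assumes "x \<in> U" "y \<in> U"
  shows "rho M d U x y = 0 \<longleftrightarrow> x = y"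
proof
  assume 0: "rho M d U x y = 0"
  obtain p where p: "p \<in> boundary M d U" using boundary_nonempty by blast
  have "d x y / (d p x * d p y) \<le> 0" using exp_rho_ge[OF assms p] 0 by simp
  moreover have "0 < d p x * d p y"
    using boundary_dist_pos p assms by simp
  ultimately have "d x y \<le> 0" by (simp add: divide_le_0_iff)
  then show "x = y" using assms U_subset by (metis antisym nonneg subsetD zero)
next
  assume "x = y"
  then have "exp (rho M d U x y) \<le> 1"
    using assms U_subset by (intro exp_rho_le) (simp_all add: subset_iff)
  then show "rho M d U x y = 0" using rho_nonneg[of x y] by simp
qed

text \<open>
  Ptolemy's inequality for \<open>x, y, p, z\<close> is the triangle inequality for the inversion
  \<open>d x y / (d p x * d p y)\<close> of the metric at \<open>p\<close>.
\<close>

lemma exp_rho_triangle: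
  assumes ptol: "ptolemaic M d" and U: "x \<in> U" "y \<in> U" "z \<in> U"
  shows "exp (rho M d U x y) \<le> exp (rho M d U x z) + exp (rho M d U z y) - 1"
proof (rule exp_rho_le[OF U(1,2)])
  fix p assume p: "p \<in> boundary M d U"
  have pos: "0 < d p x" "0 < d p y" "0 < d p z"
    using boundary_dist_pos p U by auto
  have "p \<in> M" "x \<in> M" "y \<in> M" "z \<in> M" using boundary_subset p U U_subset by auto
  then have "d x y * d p z \<le> d x p * d y z + d x z * d y p"
    using ptol unfolding ptolemaic_def by blast
  then have "d x y / (d p x * d p y) \<le> d x z / (d p x * d p z) + d z y / (d p z * d p y)"
    using pos by (simp add: field_simps commute)
  then show "1 + d x y / (d p x * d p y) \<le> exp (rho M d U x z) + exp (rho M d U z y) - 1"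
    using exp_rho_ge[OF U(1,3) p] exp_rho_ge[OF U(3,2) p] by simp
qed

lemma Metric_space_rho:
  assumes "ptolemaic M d"
  shows "Metric_space U (rho M d U)"
proof
  fix x y z assume U: "x \<in> U" "y \<in> U" "z \<in> U"
  \<comment> \<open>Expanding this product gives \<open>A + B - 1 \<le> A * B\<close> for the two
    exponentials \<open>A\<close> and \<open>B\<close>, which turns the additive bound into a
    multiplicative one.\<close>
  have "0 \<le> (exp (rho M d U x y) - 1) * (exp (rho M d U y z) - 1)"
    by (simp add: rho_nonneg)
  with exp_rho_triangle[OF assms U(1,3,2)]
  have "exp (rho M d U x z) \<le> exp (rho M d U x y) * exp (rho M d U y z)"
    by (simp add: algebra_simps)
  then show "rho M d U x z \<le> rho M d U x y + rho M d U y z"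
    by (simp flip: exp_add)
qed (auto simp: rho_nonneg rho_eq_0_iff intro: rho_commute)

lemma strongly_hyperbolic_rho:
  assumes "ptolemaic M d"
  shows "strongly_hyperbolic U (rho M d U) 1"
proof (rule strongly_hyperbolic_1_if_exp_triangle[OF rho_commute])
  fix x y z assume "x \<in> U" "y \<in> U" "z \<in> U"
  from exp_rho_triangle[OF assms this]
  show "exp (rho M d U x y) \<le> exp (rho M d U x z) + exp (rho M d U z y)"
    by linarith
qed

lemma gromov_hyperbolic_rho: "ptolemaic M d \<Longrightarrow> gromov_hyperbolic U (rho M d U) (ln 2)"
  using gromov_hyperbolic_if_strongly_hyperbolic[OF strongly_hyperbolic_rho] by simp

end

section \<open>Sharpness on the real line\<close>

lemma ptolemaic_dist_real: "ptolemaic (UNIV :: real set) dist"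
  unfolding ptolemaic_def
proof (intro ballI)
  fix x y z t :: real
  have "(x - y) * (z - t) = (x - z) * (y - t) - (x - t) * (y - z)"
    by (simp add: algebra_simps)
  then have "\<bar>(x - y) * (z - t)\<bar> \<le> \<bar>(x - z) * (y - t)\<bar> + \<bar>(x - t) * (y - z)\<bar>"
    by linarith
  then show "dist x y * dist z t \<le> dist x z * dist y t + dist x t * dist y z"
    by (simp add: dist_real_def abs_mult)
qed

lemma boundary_real_compl_finite:
  fixes S :: "real set"
  assumes "finite S"
  shows "boundary UNIV dist (- S) = S"
  using assms
  by (simp add: frontier_of_def closure_complement interior_open open_Compl finite_imp_closed
      empty_interior_finite)

abbreviation rho01 :: "real \<Rightarrow> real \<Rightarrow> real" where
  "rho01 \<equiv> rho UNIV dist (- {0, 1})"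

lemma open_with_boundary_rho01: "open_with_boundary (UNIV :: real set) dist (- {0, 1})"
proof
  show "openin Met_TC.mtopology (- {0, 1 :: real})"
    by (simp add: open_Compl finite_imp_closed)
  show "boundary UNIV dist (- {0, 1 :: real}) \<noteq> {}"
    by (subst boundary_real_compl_finite) simp_all
qed

text \<open>Inversion of the line at 0 is realised by \<open>1 / u\<close>, at 1 by
  \<open>1 / (u - 1)\<close>. Hence \<open>exp (rho01 x y) - 1\<close> is the sup-norm distance
  between the images of \<open>x\<close> and \<open>y\<close> in the plane.\<close>

lemma exp_rho01:
  assumes U: "x \<in> - {0, 1}" "y \<in> - {0, 1}"
  shows "exp (rho01 x y) = 1 + max \<bar>1 / x - 1 / y\<bar> \<bar>1 / (x - 1) - 1 / (y - 1)\<bar>"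
proof -
  have boundary: "boundary UNIV dist (- {0, 1 :: real}) = {0, 1}"
    by (rule boundary_real_compl_finite) simp
  have 0: "dist x y / (dist 0 x * dist 0 y) = \<bar>1 / x - 1 / y\<bar>"
    using U by (simp add: dist_real_def diff_frac_eq abs_mult abs_minus_commute)
  have 1: "dist x y / (dist 1 x * dist 1 y) = \<bar>1 / (x - 1) - 1 / (y - 1)\<bar>"
    using U by (simp add: dist_real_def diff_frac_eq abs_mult abs_minus_commute)
  have "exp (rho01 x y) \<le> 1 + max \<bar>1 / x - 1 / y\<bar> \<bar>1 / (x - 1) - 1 / (y - 1)\<bar>"
  proof (rule open_with_boundary.exp_rho_le[OF open_with_boundary_rho01 U])
    fix p assume "p \<in> boundary UNIV dist (- {0, 1 :: real})"
    then consider "p = 0" | "p = 1" unfolding boundary by blast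
    then show "1 + dist x y / (dist p x * dist p y)
        \<le> 1 + max \<bar>1 / x - 1 / y\<bar> \<bar>1 / (x - 1) - 1 / (y - 1)\<bar>"
      by cases (simp_all only: 0 1 add_le_cancel_left max.cobounded1 max.cobounded2)
  qed
  moreover have "1 + \<bar>1 / x - 1 / y\<bar> \<le> exp (rho01 x y)"
    unfolding 0[symmetric]
    by (rule open_with_boundary.exp_rho_ge[OF open_with_boundary_rho01 U]) (subst boundary, simp)
  moreover have "1 + \<bar>1 / (x - 1) - 1 / (y - 1)\<bar> \<le> exp (rho01 x y)"
    unfolding 1[symmetric]
    by (rule open_with_boundary.exp_rho_ge[OF open_with_boundary_rho01 U]) (subst boundary, simp)
  ultimately show ?thesis by linarith
qed

text \<open>
  For large \<open>s\<close>, the map \<open>u \<mapsto> (1 / u, 1 / (u - 1))\<close> sends \<open>-1/s\<close>, \<open>1/s\<close>, \<open>1 - 1/s\<close>, \<open>1 + 1/s\<close> close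
  to the midpoints of the sides of a square of side \<open>2s\<close>. In the sup norm, opposite midpoints are
  about twice as far apart as adjacent ones.
\<close>

lemma not_gromov_hyperbolic_rho01:
  assumes "\<delta> < ln 2"
  shows "\<not> gromov_hyperbolic (- {0, 1}) rho01 \<delta>"
proof
  assume hyp: "gromov_hyperbolic (- {0, 1}) rho01 \<delta>"
  define e where "e = exp \<delta>"
  \<comment> \<open>Any \<open>s\<close> with \<open>(2 - e) * s > 3 * e - 1\<close> gives
    \<open>e * (3 + s) < 1 + 2 * s\<close>; since \<open>e < 2\<close>, the right side is below 5
    and the value 6 is enough.\<close>
  define s where "s = 6 / (2 - e)"
  have e: "0 < e" "e < 2" using exp_less_mono[OF assms] by (simp_all add: e_def)
  then have "2 < s"
    by (simp add: s_def less_divide_eq)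
  have "(2 - e) * s = 6"
    using e unfolding s_def times_divide_eq_right
    by (intro nonzero_mult_div_cancel_left) simp
  then have s: "2 < s" "e * (3 + s) < 1 + 2 * s"
    using e \<open>2 < s\<close> by (simp_all add: algebra_simps)
  define x y z t where "x = - 1 / s" and "y = 1 / s" and "z = 1 - 1 / s" and "t = 1 + 1 / s"
  have U: "x \<in> - {0, 1}" "y \<in> - {0, 1}" "z \<in> - {0, 1}" "t \<in> - {0, 1}"
    using s by (auto simp: x_def y_def z_def t_def field_simps)
  \<comment> \<open>Up to sign, these are the small coordinates of the four image points, that is,
    their offsets from the midpoints of the sides.\<close>
  define a b where "a = s / (s + 1)" and "b = s / (s - 1)"
  have ab: "0 < a" "a < 1" "0 < b" "b \<le> 2"
    using s by (simp_all add: a_def b_def field_simps)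
  have image: "1 / x = - s" "1 / (x - 1) = - a" "1 / y = s" "1 / (y - 1) = - b"
    "1 / z = b" "1 / (z - 1) = - s" "1 / t = a" "1 / (t - 1) = s"
    using s by (simp_all add: x_def y_def z_def t_def a_def b_def field_simps)
  note exp_rho = exp_rho01[OF U(1,2)] exp_rho01[OF U(3,4)] exp_rho01[OF U(1,3)]
    exp_rho01[OF U(2,4)] exp_rho01[OF U(1,4)] exp_rho01[OF U(2,3)]
  \<comment> \<open>Each opposite pair has the values \<open>s\<close> and \<open>- s\<close> in one
    coordinate.\<close>
  have long: "1 + 2 * s \<le> exp (rho01 x y)" "1 + 2 * s \<le> exp (rho01 z t)"
    using s ab unfolding exp_rho image by linarith+
  \<comment> \<open>For adjacent points, each coordinate pairs a value of modulus \<open>s\<close>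
    with one of modulus at most 2.\<close>
  have short: "exp (rho01 x z) \<le> 3 + s" "exp (rho01 y t) \<le> 3 + s"
    "exp (rho01 x t) \<le> 3 + s" "exp (rho01 y z) \<le> 3 + s"
    using s ab unfolding exp_rho image by linarith+
  have "(1 + 2 * s)\<^sup>2 \<le> exp (rho01 x y + rho01 z t)"
    using s long unfolding exp_add power2_eq_square by (intro mult_mono) auto
  also have "\<dots> \<le> exp (max (rho01 x z + rho01 y t) (rho01 x t + rho01 y z) + 2 * \<delta>)"
    using hyp U unfolding gromov_hyperbolic_def exp_le_cancel_iff by blast
  also have "\<dots> = exp (max (rho01 x z + rho01 y t) (rho01 x t + rho01 y z)) * e\<^sup>2"
    by (simp only: exp_add[of "max _ _"] exp_double e_def)
  also have "\<dots> \<le> ((3 + s) * (3 + s)) * e\<^sup>2"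
  proof (intro mult_right_mono)
    have "exp (rho01 x z + rho01 y t) \<le> (3 + s) * (3 + s)"
      "exp (rho01 x t + rho01 y z) \<le> (3 + s) * (3 + s)"
      using s short unfolding exp_add by (intro mult_mono; simp)+
    then show "exp (max (rho01 x z + rho01 y t) (rho01 x t + rho01 y z)) \<le> (3 + s) * (3 + s)"
      unfolding max_def by simp
  qed simp
  also have "\<dots> = (e * (3 + s))\<^sup>2"
    by (simp add: power2_eq_square)
  finally have "1 + 2 * s \<le> e * (3 + s)"
    using s e by (intro power2_le_imp_le[of "1 + 2 * s"]) auto
  with s show False by simp
qed

lemma not_strongly_hyperbolic_rho01: "1 < \<epsilon> \<Longrightarrow> \<not> strongly_hyperbolic (- {0, 1}) rho01 \<epsilon>"
  using gromov_hyperbolic_if_strongly_hyperbolic[of "- {0, 1}" rho01 \<epsilon>]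
    not_gromov_hyperbolic_rho01[of "ln 2 / \<epsilon>"] by (auto simp: field_simps)

text \<open>The variable \<open>P\<close> stands for either hyperbolicity predicate with its
  parameter fixed, so both sharpness claims share one witness.\<close>

lemma exists_domain_if_rho01:
  assumes "\<not> P (- {0, 1}) rho01"
  shows "\<exists>(X :: real set) d U.
    Metric_space X d \<and> ptolemaic X d \<and>
    openin (Metric_space.mtopology X d) U \<and>
    (\<exists>p\<in>boundary X d U. \<exists>q\<in>boundary X d U. p \<noteq> q) \<and>
    \<not> P U (rho X d U)"
proof (rule exI, rule exI, rule exI, intro conjI)
  show "\<exists>p\<in>boundary UNIV dist (- {0, 1 :: real}). \<exists>q\<in>boundary UNIV dist (- {0, 1}). p \<noteq> q"
    by (subst (1 2) boundary_real_compl_finite) auto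
qed (fact Met_TC.Metric_space_axioms ptolemaic_dist_real assms
    open_with_boundary.open_U[OF open_with_boundary_rho01])+

theorem theorem1p1:
  shows "(\<forall>(X :: 'a set) d U.
            Metric_space X d \<longrightarrow> ptolemaic X d \<longrightarrow>
            openin (Metric_space.mtopology X d) U \<longrightarrow> boundary X d U \<noteq> {} \<longrightarrow>
            Metric_space U (rho X d U) \<and>
            gromov_hyperbolic U (rho X d U) (ln 2) \<and>
            strongly_hyperbolic U (rho X d U) 1)
       \<and> (\<forall>\<delta>. 0 < \<delta> \<and> \<delta> < ln 2 \<longrightarrow>
            (\<exists>(X :: real set) d U.
              Metric_space X d \<and> ptolemaic X d \<and>
              openin (Metric_space.mtopology X d) U \<and>
              (\<exists>p\<in>boundary X d U. \<exists>q\<in>boundary X d U. p \<noteq> q) \<and>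
              \<not> gromov_hyperbolic U (rho X d U) \<delta>))
       \<and> (\<forall>\<epsilon>>1.
            (\<exists>(X :: real set) d U.
              Metric_space X d \<and> ptolemaic X d \<and>
              openin (Metric_space.mtopology X d) U \<and>
              (\<exists>p\<in>boundary X d U. \<exists>q\<in>boundary X d U. p \<noteq> q) \<and>
              \<not> strongly_hyperbolic U (rho X d U) \<epsilon>))"
  by (intro conjI allI impI exists_domain_if_rho01 not_gromov_hyperbolic_rho01
      not_strongly_hyperbolic_rho01 open_with_boundary.Metric_space_rho
      open_with_boundary.gromov_hyperbolic_rho open_with_boundary.strongly_hyperbolic_rho)
    (simp_all add: open_with_boundary_def open_with_boundary_axioms_def)

end
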